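(* Let $S$ be the facial monoid with generators $s_i$, $i\in\mathbf{N}$. For every $n\geq 2$, the sub-monoid $S_n<S$ generated by $s_1,\ldots,s_n$ is non-amenable.
   Context: $\mathbf{N}=\{1,2,\ldots\}$. The facial monoid is the monoid given by the monoid presentation $S=\langle s_i\ (i\in\mathbf{N}) : s_js_i=s_is_{j+1}\ \forall\,1\leq i\leq j\rangle$. Amenability of a monoid $M$: every non-empty convex compact $M$-space has a fixed point, where a convex compact $M$-space is a convex compact set $K$ in a Hausdorff topological vector space $V$ together with an $M$-action on $V$ by continuous affine transformations preserving $K$. By a theorem of Day this is equivalent to the existence of a left-invariant mean on $M$, i.e. a positive normalized linear functional $m$ on $\ell^\infty(M)$ with $m(x\mapsto f(sx))=m(f)$ for all $f\in\ell^\infty(M)$ and $s\in M$. *)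

theory Defs
  imports "HOL-Algebra.Group" "HOL-Probability.Discrete_Topology"
begin

section \<open>Monoid presentations\<close>

text \<open>The congruence on the free monoid \<^term>\<open>lists X\<close> generated by the relations \<open>R\<close>.\<close>

inductive_set presentation_cong :: "'a set \<Rightarrow> ('a list \<times> 'a list) set \<Rightarrow> ('a list \<times> 'a list) set"
  for X :: "'a set" and R :: "('a list \<times> 'a list) set" where
  rel: "\<lbrakk>(u, v) \<in> R; u \<in> lists X; v \<in> lists X; p \<in> lists X; q \<in> lists X\<rbrakk>
        \<Longrightarrow> (p @ u @ q, p @ v @ q) \<in> presentation_cong X R"
| refl: "w \<in> lists X \<Longrightarrow> (w, w) \<in> presentation_cong X R"
| sym: "(u, v) \<in> presentation_cong X R \<Longrightarrow> (v, u) \<in> presentation_cong X R"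
| trans: "\<lbrakk>(u, v) \<in> presentation_cong X R; (v, w) \<in> presentation_cong X R\<rbrakk>
          \<Longrightarrow> (u, w) \<in> presentation_cong X R"

definition word_class :: "'a set \<Rightarrow> ('a list \<times> 'a list) set \<Rightarrow> 'a list \<Rightarrow> 'a list set" where
  "word_class X R w = presentation_cong X R `` {w}"

definition presented_monoid :: "'a set \<Rightarrow> ('a list \<times> 'a list) set \<Rightarrow> 'a list set monoid" where
  "presented_monoid X R =
     \<lparr>carrier = lists X // presentation_cong X R,
      monoid.mult = (\<lambda>A B. \<Union>u\<in>A. \<Union>v\<in>B. word_class X R (u @ v)),
      one = word_class X R []\<rparr>"

lemma presentation_cong_lists:
  "(u, v) \<in> presentation_cong X R \<Longrightarrow> u \<in> lists X \<and> v \<in> lists X"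
  by (induction rule: presentation_cong.induct) auto

lemma equiv_presentation_cong: "equiv (lists X) (presentation_cong X R)"
proof (rule equivI)
  show "presentation_cong X R \<subseteq> lists X \<times> lists X"
    by (rule subrelI) (simp only: mem_Sigma_iff presentation_cong_lists)
  show "refl_on (lists X) (presentation_cong X R)"
    by (rule refl_onI) (rule presentation_cong.refl)
  show "Relation.sym (presentation_cong X R)"
    by (rule symI) (rule presentation_cong.sym)
  show "Relation.trans (presentation_cong X R)"
    by (rule transI) (rule presentation_cong.trans)
qed

lemma presentation_cong_context:
  assumes "(u, v) \<in> presentation_cong X R" "p \<in> lists X" "q \<in> lists X"
  shows "(p @ u @ q, p @ v @ q) \<in> presentation_cong X R"
  using assms
proof (induction rule: presentation_cong.induct)
  case (rel u v p' q')
  then show ?case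
    using presentation_cong.rel[of u v R X "p @ p'" "q' @ q"] by auto
next
  case (refl w)
  then show ?case by (intro presentation_cong.refl) auto
next
  case (sym u v)
  then show ?case by (blast intro: presentation_cong.sym)
next
  case (trans u v w)
  then show ?case by (meson presentation_cong.trans)
qed

lemma presentation_cong_append:
  assumes "(u, u') \<in> presentation_cong X R" "(v, v') \<in> presentation_cong X R"
  shows "(u @ v, u' @ v') \<in> presentation_cong X R"
proof (rule presentation_cong.trans)
  show "(u @ v, u' @ v) \<in> presentation_cong X R"
    using presentation_cong_context[OF assms(1), of "[]" v]
      presentation_cong_lists[OF assms(2)] by simp
  show "(u' @ v, u' @ v') \<in> presentation_cong X R"
    using presentation_cong_context[OF assms(2), of u' "[]"]
      presentation_cong_lists[OF assms(1)] by simp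
qed

lemma word_class_eq_iff:
  "\<lbrakk>u \<in> lists X; v \<in> lists X\<rbrakk> \<Longrightarrow>
   word_class X R u = word_class X R v \<longleftrightarrow> (u, v) \<in> presentation_cong X R"
  unfolding word_class_def by (rule eq_equiv_class_iff[OF equiv_presentation_cong])

lemma carrier_presented_monoid:
  "carrier (presented_monoid X R) = word_class X R ` lists X"
  by (auto simp: presented_monoid_def word_class_def quotient_def)

lemma one_presented_monoid: "\<one>\<^bsub>presented_monoid X R\<^esub> = word_class X R []"
  by (simp add: presented_monoid_def)

lemma mult_word_class:
  assumes "u \<in> lists X" "v \<in> lists X"
  shows "word_class X R u \<otimes>\<^bsub>presented_monoid X R\<^esub> word_class X R v = word_class X R (u @ v)"
proof -
  have "word_class X R (u' @ v') = word_class X R (u @ v)"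
    if "u' \<in> word_class X R u" "v' \<in> word_class X R v" for u' v'
  proof -
    have uv: "(u, u') \<in> presentation_cong X R" "(v, v') \<in> presentation_cong X R"
      using that by (auto simp: word_class_def)
    have "(u' @ v', u @ v) \<in> presentation_cong X R"
      by (rule presentation_cong.sym) (rule presentation_cong_append[OF uv])
    then show ?thesis
      unfolding word_class_def by (rule equiv_class_eq[OF equiv_presentation_cong])
  qed
  then have "word_class X R u \<otimes>\<^bsub>presented_monoid X R\<^esub> word_class X R v =
      (\<Union>u'\<in>word_class X R u. \<Union>v'\<in>word_class X R v. word_class X R (u @ v))"
    unfolding presented_monoid_def monoid.simps by (intro SUP_cong HOL.refl)
  moreover have "u \<in> word_class X R u" "v \<in> word_class X R v"
    using assms by (simp_all add: word_class_def presentation_cong.refl)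
  ultimately show ?thesis
    by blast
qed

lemma monoid_presented_monoid: "monoid (presented_monoid X R)"
proof -
  have app: "u @ v \<in> lists X" if "u \<in> lists X" "v \<in> lists X" for u v
    using that by simp
  have nil: "[] \<in> lists X"
    by (rule lists.Nil)
  show ?thesis
  proof (rule monoidI, unfold carrier_presented_monoid one_presented_monoid; (elim imageE)?; hypsubst?)
    fix u v assume uv: "u \<in> lists X" "v \<in> lists X"
    show "word_class X R u \<otimes>\<^bsub>presented_monoid X R\<^esub> word_class X R v \<in> word_class X R ` lists X"
      unfolding mult_word_class[OF uv] by (rule imageI) (rule app[OF uv])
  next
    fix u v w assume uvw: "u \<in> lists X" "v \<in> lists X" "w \<in> lists X"
    show "word_class X R u \<otimes>\<^bsub>presented_monoid X R\<^esub> word_class X R v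
        \<otimes>\<^bsub>presented_monoid X R\<^esub> word_class X R w =
      word_class X R u \<otimes>\<^bsub>presented_monoid X R\<^esub>
        (word_class X R v \<otimes>\<^bsub>presented_monoid X R\<^esub> word_class X R w)"
      by (simp only: mult_word_class uvw app append_assoc)
  qed (simp_all only: mult_word_class nil append_Nil append_Nil2 imageI)
qed

definition generated_submonoid :: "('m, 'b) monoid_scheme \<Rightarrow> 'm set \<Rightarrow> 'm set" where
  "generated_submonoid G A = \<Inter>{H. submonoid H G \<and> A \<subseteq> H}"

section \<open>The facial monoid\<close>

definition facial_relations :: "(nat list \<times> nat list) set" where
  "facial_relations = {([j, i], [i, j + 1]) | i j. 1 \<le> i \<and> i \<le> j}"

definition facial_monoid :: "nat list set monoid" where
  "facial_monoid = presented_monoid {1..} facial_relations"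

definition facial_gen :: "nat \<Rightarrow> nat list set" where
  "facial_gen i = word_class {1..} facial_relations [i]"

definition facial_submonoid :: "nat \<Rightarrow> nat list set monoid" where
  "facial_submonoid n =
     facial_monoid\<lparr>carrier := generated_submonoid facial_monoid (facial_gen ` {1..n})\<rparr>"

section \<open>Amenability\<close>

text \<open>
  A Hausdorff topological vector space is given by a topology \<open>T\<close> whose underlying set is a linear
  subspace of some real vector space; \<open>T\<close> need not be related to any topology on the ambient type.
\<close>

definition hausdorff_tvs :: "'v::real_vector topology \<Rightarrow> bool" where
  "hausdorff_tvs T \<longleftrightarrow>
     subspace (topspace T) \<and> Hausdorff_space T \<and>
     continuous_map (prod_topology T T) T (\<lambda>(x, y). x + y) \<and>
     continuous_map (prod_topology euclideanreal T) T (\<lambda>(c, x). c *\<^sub>R x)"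

definition continuous_affine :: "'v::real_vector topology \<Rightarrow> ('v \<Rightarrow> 'v) \<Rightarrow> bool" where
  "continuous_affine T f \<longleftrightarrow>
     continuous_map T T f \<and>
     (\<forall>x\<in>topspace T. \<forall>y\<in>topspace T. \<forall>t::real.
        f ((1 - t) *\<^sub>R x + t *\<^sub>R y) = (1 - t) *\<^sub>R f x + t *\<^sub>R f y)"

definition convex_compact_space ::
    "('m, 'b) monoid_scheme \<Rightarrow> 'v::real_vector topology \<Rightarrow> ('m \<Rightarrow> 'v \<Rightarrow> 'v) \<Rightarrow> 'v set \<Rightarrow> bool" where
  "convex_compact_space G T \<alpha> K \<longleftrightarrow>
     hausdorff_tvs T \<and>
     (\<forall>g\<in>carrier G. continuous_affine T (\<alpha> g)) \<and>
     (\<forall>x\<in>topspace T. \<alpha> \<one>\<^bsub>G\<^esub> x = x) \<and>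
     (\<forall>g\<in>carrier G. \<forall>h\<in>carrier G. \<forall>x\<in>topspace T. \<alpha> (g \<otimes>\<^bsub>G\<^esub> h) x = \<alpha> g (\<alpha> h x)) \<and>
     compactin T K \<and> convex K \<and>
     (\<forall>g\<in>carrier G. \<alpha> g ` K \<subseteq> K)"

definition fixed_point_property ::
    "('m, 'b) monoid_scheme \<Rightarrow> 'v::real_vector itself \<Rightarrow> bool" where
  "fixed_point_property G _ \<longleftrightarrow>
     (\<forall>(T :: 'v topology) \<alpha> K. convex_compact_space G T \<alpha> K \<and> K \<noteq> {} \<longrightarrow>
        (\<exists>x\<in>K. \<forall>g\<in>carrier G. \<alpha> g x = x))"

text \<open>
  A HOL formula cannot quantify over all types, so the topological vector spaces are taken inside
  one type that is large enough for the restriction to be immaterial: the (algebraic) vector space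
  underlying the dual of \<open>\<ell>\<^sup>\<infinity>('m)\<close>, where \<open>\<ell>\<^sup>\<infinity>('m)\<close> consists of the bounded functions on \<open>'m\<close>, i.e.
  of the bounded continuous functions for the discrete topology.  With the weak-* topology this
  dual contains Day's compact convex \<open>G\<close>-space of all means on \<open>G\<close>.  A fixed point there is a
  left-invariant mean, and by Day's theorem such a mean yields fixed points in every non-empty
  convex compact \<open>G\<close>-space.  Non-amenability needs no such argument: failure of the property in
  this type exhibits a convex compact \<open>G\<close>-space without fixed point.
\<close>

definition amenable :: "('m, 'b) monoid_scheme \<Rightarrow> bool" where
  "amenable G \<longleftrightarrow>
     fixed_point_property G TYPE(('m discrete \<Rightarrow>\<^sub>C real) \<Rightarrow>\<^sub>L real)"

end

theory Submission
  imports Defs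
begin

text \<open>The non-identity elements of S_n split into two non-empty disjoint right ideals: those
  with a word over s_1, ..., s_n that starts with s_n, and those with such a word starting
  otherwise. Sending the two ideals to distinct constant maps, and the identity to the identity map,
  gives an action on a segment without fixed point
  (\<open>not_amenable_if_disjoint_right_ideals\<close>). Disjointness needs an invariant of the
  presentation. The facial relations are the cosimplicial identities with composition reversed, so
  s_i \<mapsto> \<open>skip i\<close> extends to an anti-homomorphism \<open>gaps\<close> into the
  strictly increasing maps on the naturals (\<open>gaps_cong\<close>). From \<open>gaps w\<close>
  one reads off whether w starts with s_n (\<open>hd_eq_iff_gaps\<close>).\<close>

lemma hausdorff_tvs_euclidean: "hausdorff_tvs (euclidean :: 'v::real_normed_vector topology)"
proof -
  have "continuous_on UNIV (\<lambda>p :: 'v \<times> 'v. fst p + snd p)"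
    and "continuous_on UNIV (\<lambda>p :: real \<times> 'v. fst p *\<^sub>R snd p)"
    by (intro continuous_intros)+
  then show ?thesis
    by (simp add: hausdorff_tvs_def case_prod_unfold)
qed

text \<open>Evaluation at any point maps the constant function 1 to 1. The vector found here is the
  second endpoint of the segment acted upon.\<close>

lemma nontrivial_dual:
  "\<exists>v :: ('m discrete \<Rightarrow>\<^sub>C real) \<Rightarrow>\<^sub>L real. v \<noteq> 0"
proof -
  let ?ev = "\<lambda>f :: 'm discrete \<Rightarrow>\<^sub>C real. apply_bcontfun f undefined"
  have "bounded_linear ?ev"
    by (rule bounded_linear_intro[where K = 1])
      (simp_all add: norm_bounded flip: real_norm_def)
  then have "blinfun_apply (Blinfun ?ev) (const_bcontfun 1) = 1"
    by (simp add: bounded_linear_Blinfun_apply const_bcontfun.rep_eq)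
  then show ?thesis
    by (metis blinfun.zero_left zero_neq_one)
qed

text \<open>
  The elements of two disjoint right ideals act by two different constant maps; this respects
  products since the constant is decided by the left factor.
\<close>

lemma not_amenable_if_disjoint_right_ideals:
  assumes "monoid G"
    and carrier: "carrier G \<subseteq> insert \<one>\<^bsub>G\<^esub> (A \<union> B)"
    and one: "\<one>\<^bsub>G\<^esub> \<notin> A \<union> B"
    and disjoint: "A \<inter> B = {}"
    and nonempty: "A \<inter> carrier G \<noteq> {}" "B \<inter> carrier G \<noteq> {}"
    and ideal: "\<And>a h. a \<in> A \<Longrightarrow> h \<in> carrier G \<Longrightarrow> a \<otimes>\<^bsub>G\<^esub> h \<in> A"
      "\<And>b h. b \<in> B \<Longrightarrow> h \<in> carrier G \<Longrightarrow> b \<otimes>\<^bsub>G\<^esub> h \<in> B"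
  shows "\<not> amenable G"
proof
  assume "amenable G"
  interpret monoid G by fact
  obtain v :: "('a discrete \<Rightarrow>\<^sub>C real) \<Rightarrow>\<^sub>L real" where v: "v \<noteq> 0"
    using nontrivial_dual by blast
  define \<alpha> where "\<alpha> g x = (if g \<in> A then 0 else if g \<in> B then v else x)" for g x
  have affine: "continuous_affine euclidean (\<alpha> g)" for g
    by (cases "g \<in> A"; cases "g \<in> B")
      (simp_all add: continuous_affine_def \<alpha>_def flip: scaleR_left_distrib)
  have mult: "\<alpha> (g \<otimes>\<^bsub>G\<^esub> h) x = \<alpha> g (\<alpha> h x)" if "g \<in> carrier G" "h \<in> carrier G" for g h x
  proof -
    consider "g \<in> A" | "g \<in> B" | "g = \<one>\<^bsub>G\<^esub>"
      using \<open>g \<in> carrier G\<close> carrier by blast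
    then show ?thesis
    proof cases
      case 1
      with ideal(1) that show ?thesis
        by (simp add: \<alpha>_def)
    next
      case 2
      with ideal(2) that have "g \<otimes>\<^bsub>G\<^esub> h \<in> B"
        by blast
      with 2 disjoint have "g \<notin> A" "g \<otimes>\<^bsub>G\<^esub> h \<notin> A"
        by blast+
      with 2 \<open>g \<otimes>\<^bsub>G\<^esub> h \<in> B\<close> show ?thesis
        by (simp add: \<alpha>_def)
    next
      case 3
      with one that show ?thesis
        by (simp add: \<alpha>_def)
    qed
  qed
  have "convex_compact_space G euclidean \<alpha> (closed_segment 0 v)"
  proof -
    have "\<alpha> g ` closed_segment 0 v \<subseteq> closed_segment 0 v" for g
      by (auto simp: \<alpha>_def)
    moreover have "\<alpha> \<one>\<^bsub>G\<^esub> x = x" for x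
      using one by (simp add: \<alpha>_def)
    ultimately show ?thesis
      by (simp add: convex_compact_space_def hausdorff_tvs_euclidean affine mult)
  qed
  then obtain x where x: "\<And>g. g \<in> carrier G \<Longrightarrow> \<alpha> g x = x"
    using \<open>amenable G\<close> unfolding amenable_def fixed_point_property_def
    by (metis ends_in_segment(1) empty_iff)
  obtain a b where ab: "a \<in> A" "a \<in> carrier G" "b \<in> B" "b \<in> carrier G"
    using nonempty by blast
  then have "b \<notin> A"
    using disjoint by blast
  \<comment> \<open>The fixed point would equal 0 because of a and v because of b.\<close>
  with ab x[of a] x[of b] v show False
    by (simp add: \<alpha>_def)
qed

lemma generated_submonoid_incl: "a \<in> A \<Longrightarrow> a \<in> generated_submonoid G A"
  by (auto simp: generated_submonoid_def)

lemma generated_submonoid_minimal: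
  "submonoid H G \<Longrightarrow> A \<subseteq> H \<Longrightarrow> generated_submonoid G A \<subseteq> H"
  by (auto simp: generated_submonoid_def)

lemma submonoid_generated_submonoid:
  assumes "monoid G" "A \<subseteq> carrier G"
  shows "submonoid (generated_submonoid G A) G"
proof
  interpret monoid G by fact
  have "submonoid (carrier G) G"
    by unfold_locales auto
  with assms(2) show "generated_submonoid G A \<subseteq> carrier G"
    by (intro generated_submonoid_minimal)
qed (auto simp: generated_submonoid_def submonoid.m_closed submonoid.one_closed)

text \<open>The i-th coface map: the increasing injection that misses exactly i.\<close>

definition skip :: "nat \<Rightarrow> nat \<Rightarrow> nat" where
  "skip i k = (if k < i then k else Suc k)"

text \<open>
  \<^term>\<open>gaps w\<close> enumerates the complement of the finite set of naturals that represents the word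
  \<^term>\<open>w\<close>: multiplying by \<open>s\<^sub>i\<close> on the left removes the \<open>i\<close>-th missing number from the complement.
\<close>

primrec gaps :: "nat list \<Rightarrow> nat \<Rightarrow> nat" where
  "gaps [] = id"
| "gaps (i # w) = gaps w \<circ> skip i"

lemma skip_skip: "i \<le> j \<Longrightarrow> skip i (skip j k) = skip (Suc j) (skip i k)"
  by (auto simp: skip_def)

lemma gaps_append: "gaps (u @ v) = gaps v \<circ> gaps u"
  by (induction u) (auto simp: comp_assoc)

lemma gaps_cong:
  "(u, v) \<in> presentation_cong X facial_relations \<Longrightarrow> gaps u = gaps v"
proof (induction rule: presentation_cong.induct)
  case (rel u v p q)
  from rel.hyps(1) obtain i j where "u = [j, i]" "v = [i, j + 1]" "i \<le> j"
    by (auto simp: facial_relations_def)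
  then show ?case
    by (simp add: gaps_append fun_eq_iff skip_skip)
qed auto

lemma strict_mono_skip: "strict_mono (skip i)"
  by (auto simp: strict_mono_def skip_def)

lemma strict_mono_gaps: "strict_mono (gaps w)"
proof (induction w)
  case (Cons i w)
  then show ?case
    using strict_mono_skip[of i] by (simp add: strict_mono_def)
qed (simp add: strict_mono_def)

text \<open>For letters i \<le> n, each \<open>skip i\<close> is the successor on {n..}, so beyond n
  the composite is a translation. Larger letters would break this.\<close>

lemma gaps_Suc:
  assumes "w \<in> lists {1..n}" "n \<le> k"
  shows "gaps w (Suc k) = Suc (gaps w k)"
  using assms by (induction w arbitrary: k) (auto simp: skip_def)

lemma less_gaps_if_nonempty:
  assumes "w \<in> lists {1..n}" "w \<noteq> []"
  shows "n < gaps w n"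
proof (cases w)
  case (Cons i u)
  have "Suc n \<le> gaps u (Suc n)"
    by (rule strict_mono_imp_increasing[OF strict_mono_gaps])
  with Cons assms show ?thesis
    by (simp add: skip_def)
qed (use assms in simp)

text \<open>The first letter i acts first. If i < n, it moves n - 1 and n to n and n + 1, which the
  remaining letters keep adjacent by \<open>gaps_Suc\<close>. If i = n, it moves them to n - 1 and n
  + 1, and the image of n stays strictly between.\<close>

lemma hd_eq_iff_gaps:
  assumes "w \<in> lists {1..n}" "w \<noteq> []" "n \<ge> 2"
  shows "hd w = n \<longleftrightarrow> gaps w n \<noteq> Suc (gaps w (n - 1))"
proof (cases w)
  case (Cons i u)
  have "gaps u (n - 1) < gaps u n"
    using assms(3) by (intro strict_monoD[OF strict_mono_gaps]) simp
  moreover have "gaps u (Suc n) = Suc (gaps u n)"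
    using assms Cons by (intro gaps_Suc[of u n]) auto
  ultimately show ?thesis
    using assms Cons by (auto simp: skip_def)
qed (use assms in simp)

lemma word_class_mult_facial:
  assumes "u \<in> lists {1..n}" "v \<in> lists {1..n}"
  shows "word_class {1..} facial_relations u \<otimes>\<^bsub>facial_monoid\<^esub> word_class {1..} facial_relations v
    = word_class {1..} facial_relations (u @ v)"
  unfolding facial_monoid_def using assms by (intro mult_word_class) auto

lemma generated_facial_subset:
  "generated_submonoid facial_monoid (facial_gen ` {1..n})
    \<subseteq> word_class {1..} facial_relations ` lists {1..n}"
proof (rule generated_submonoid_minimal)
  show "submonoid (word_class {1..} facial_relations ` lists {1..n}) facial_monoid"
  proof
    show "word_class {1..} facial_relations ` lists {1..n} \<subseteq> carrier facial_monoid"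
      unfolding facial_monoid_def carrier_presented_monoid by (intro image_mono lists_mono) auto
    show "\<one>\<^bsub>facial_monoid\<^esub> \<in> word_class {1..} facial_relations ` lists {1..n}"
      by (simp add: facial_monoid_def one_presented_monoid)
    show "x \<otimes>\<^bsub>facial_monoid\<^esub> y \<in> word_class {1..} facial_relations ` lists {1..n}"
      if xy: "x \<in> word_class {1..} facial_relations ` lists {1..n}"
        "y \<in> word_class {1..} facial_relations ` lists {1..n}" for x y
    proof -
      obtain u v where uv: "x = word_class {1..} facial_relations u" "u \<in> lists {1..n}"
        "y = word_class {1..} facial_relations v" "v \<in> lists {1..n}"
        using xy by blast
      have "x \<otimes>\<^bsub>facial_monoid\<^esub> y = word_class {1..} facial_relations (u @ v)"
        unfolding uv(1,3) by (rule word_class_mult_facial[OF uv(2,4)])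
      moreover have "u @ v \<in> lists {1..n}"
        using uv(2,4) by simp
      ultimately show ?thesis
        by blast
    qed
  qed
qed (auto simp: facial_gen_def)

text \<open>
  After a left multiplication by \<open>s\<^sub>i\<close> with \<open>i < n\<close> the gaps number \<open>n - 1\<close> and \<open>n\<close> are adjacent,
  after one by \<open>s\<^sub>n\<close> they are not. So whether an element of \<open>S\<^sub>n\<close> starts with \<open>s\<^sub>n\<close> is well defined,
  although \<open>s\<^sub>n\<close> and \<open>s\<^sub>i\<close> do have common right multiples in the whole facial monoid.
\<close>

theorem proposition4p5:
  fixes n :: nat
  assumes "n \<ge> 2"
  shows "\<not> amenable (facial_submonoid n)"
proof -
  let ?c = "word_class {1..} facial_relations"
  \<comment> \<open>Membership asks only for some representative with a suitable first letter; that
    the choice does not matter for \<open>i = n\<close> comes later, from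
    \<open>gaps\<close>.\<close>
  define L where "L P = {?c w | w. w \<in> lists {1..n} \<and> w \<noteq> [] \<and> P (hd w)}" for P
  have facial: "monoid facial_monoid"
    unfolding facial_monoid_def by (rule monoid_presented_monoid)
  have gens: "facial_gen ` {1..n} \<subseteq> carrier facial_monoid"
    by (auto simp: facial_gen_def facial_monoid_def carrier_presented_monoid)
  have one: "\<one>\<^bsub>facial_submonoid n\<^esub> = ?c []"
    by (simp add: facial_submonoid_def facial_monoid_def one_presented_monoid)
  have word: "\<exists>w\<in>lists {1..n}. h = ?c w" if "h \<in> carrier (facial_submonoid n)" for h
    using that generated_facial_subset[of n] unfolding facial_submonoid_def by auto
  have gaps_eq: "gaps u = gaps v" if "?c u = ?c v" "u \<in> lists {1..n}" "v \<in> lists {1..n}" for u v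
  proof (rule gaps_cong)
    have "u \<in> lists {1..}" "v \<in> lists {1..}"
      using that(2,3) by auto
    then show "(u, v) \<in> presentation_cong {1..} facial_relations"
      using that(1) by (simp add: word_class_eq_iff)
  qed
  have one_notin: "\<one>\<^bsub>facial_submonoid n\<^esub> \<notin> L P" for P
  proof
    assume "\<one>\<^bsub>facial_submonoid n\<^esub> \<in> L P"
    then obtain w where w: "?c [] = ?c w" "w \<in> lists {1..n}" "w \<noteq> []"
      unfolding one L_def by blast
    then have "gaps w = id"
      using gaps_eq[of "[]" w] by simp
    with less_gaps_if_nonempty[OF w(2,3)] show False
      by simp
  qed
  have gen: "?c [i] \<in> L P \<inter> carrier (facial_submonoid n)" if "i \<in> {1..n}" "P i" for i P
  proof
    show "?c [i] \<in> L P"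
      unfolding L_def using that by (intro CollectI exI[of _ "[i]"]) simp
    show "?c [i] \<in> carrier (facial_submonoid n)"
      using generated_submonoid_incl[OF imageI[OF that(1)]]
      by (simp add: facial_submonoid_def facial_gen_def)
  qed
  have ideal: "a \<otimes>\<^bsub>facial_submonoid n\<^esub> h \<in> L P"
    if a: "a \<in> L P" and h: "h \<in> carrier (facial_submonoid n)" for a h P
  proof -
    obtain u where u: "a = ?c u" "u \<in> lists {1..n}" "u \<noteq> []" "P (hd u)"
      using a unfolding L_def by blast
    obtain v where v: "h = ?c v" "v \<in> lists {1..n}"
      using word[OF h] by blast
    have "a \<otimes>\<^bsub>facial_submonoid n\<^esub> h = ?c (u @ v)"
      using word_class_mult_facial[OF u(2) v(2)] by (simp add: facial_submonoid_def u(1) v(1))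
    then show ?thesis
      unfolding L_def using u v(2) by (intro CollectI exI[of _ "u @ v"]) simp
  qed
  show ?thesis
  proof (rule not_amenable_if_disjoint_right_ideals)
    show "monoid (facial_submonoid n)"
      unfolding facial_submonoid_def
      using facial submonoid_generated_submonoid[OF facial gens]
      by (rule submonoid.submonoid_is_monoid[rotated])
    show "carrier (facial_submonoid n)
        \<subseteq> insert \<one>\<^bsub>facial_submonoid n\<^esub> (L (\<lambda>i. i = n) \<union> L (\<lambda>i. i \<noteq> n))"
      unfolding one L_def using word by blast
    show "\<one>\<^bsub>facial_submonoid n\<^esub> \<notin> L (\<lambda>i. i = n) \<union> L (\<lambda>i. i \<noteq> n)"
      using one_notin by blast
    have False if "?c u = ?c w" "u \<in> lists {1..n}" "w \<in> lists {1..n}" "u \<noteq> []" "w \<noteq> []"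
      "hd u = n" "hd w \<noteq> n" for u w
      using hd_eq_iff_gaps[of u n] hd_eq_iff_gaps[of w n] gaps_eq[of u w] that assms by metis
    then show "L (\<lambda>i. i = n) \<inter> L (\<lambda>i. i \<noteq> n) = {}"
      unfolding L_def by blast
    show "L (\<lambda>i. i = n) \<inter> carrier (facial_submonoid n) \<noteq> {}"
      using gen[of n "\<lambda>i. i = n"] assms by auto
    \<comment> \<open>The generator s_1 differs from s_n because n \<ge> 2.\<close>
    show "L (\<lambda>i. i \<noteq> n) \<inter> carrier (facial_submonoid n) \<noteq> {}"
      using gen[of 1 "\<lambda>i. i \<noteq> n"] assms by auto
  qed (rule ideal; assumption)+
qed

end
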